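(* Let $v$ be a $C^2$ function such that the strategy $\sigma=i\circ v'$ converges to $\bar k$. Then $v$ satisfies the integrated equation $$v(k)=\int_0^\infty h(t)\,u\Big(i\circ v'\big(\mathcal{K}(i\circ v';t,k)\big)\Big)\,dt\qquad\text{for all }k$$ if and only if it satisfies the functional equation $$-\int_0^\infty h'(t)\,u\circ i\Big(v'\big(\mathcal{K}(i\circ v';t,k)\big)\Big)\,dt=\sup_{c}\big[u(c)+v'(k)(f(k)-c)\big]\qquad\text{for all }k$$ together with the boundary condition $$v(\bar k)=u(f(\bar k))\int_0^\infty h(t)\,dt.$$
   Context: Data. The utility function $u$ is defined on an open interval $C\subseteq\mathbb{R}$ of admissible consumption levels (the supremum over $c$ is over $C$) and is strictly increasing, twice continuously differentiable and strictly concave; $i$ denotes the inverse function of $u'$, and $i\circ v'(x)=i(v'(x))$ (so $v'$ is understood to take values in the range of $u'$). The discount function $h:[0,\infty)\to[0,\infty)$ is continuously differentiable with $h(0)=1$ and $\int_0^\infty h(s)\,ds<\infty$. The production function $f$ is strictly increasing, concave and continuously differentiable. State space. The variable $k$ ranges over an open interval $K\subseteq\mathbb{R}$ ($K=\mathbb{R}$, or a neighbourhood of $\bar k$) containing $\bar k$, on which $f$ and $v$ are defined. A strategy is a continuously differentiable function $\sigma:K\to C$. Its flow $\mathcal{K}(\sigma;t,k)$ is defined by $$\frac{\partial \mathcal{K}(\sigma;t,k)}{\partial t}=f(\mathcal{K}(\sigma;t,k))-\sigma(\mathcal{K}(\sigma;t,k)),\qquad \mathcal{K}(\sigma;0,k)=k.$$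 That $\sigma$ converges to $\bar k$ means that $\mathcal{K}(\sigma;t,k)\to\bar k$ as $t\to\infty$ for initial values $k$ sufficiently close to $\bar k$; the interval $K$ is understood to consist of such initial values, i.e. for every $k\in K$ the flow exists and stays in $K$ for all $t\ge0$ and converges to $\bar k$. In that case $f(\bar k)=\sigma(\bar k)$. Standing convention: the integrals involved converge, and their derivatives can be computed by differentiating under the integral sign. *)

theory Defs
  imports "HOL-Analysis.Analysis"
begin

definition strictly_concave_on :: "real set \<Rightarrow> (real \<Rightarrow> real) \<Rightarrow> bool" where
  "strictly_concave_on S g \<longleftrightarrow> convex S \<and>
     (\<forall>x\<in>S. \<forall>y\<in>S. \<forall>a. x \<noteq> y \<longrightarrow> 0 < a \<longrightarrow> a < 1 \<longrightarrow>
        (1 - a) * g x + a * g y < g ((1 - a) * x + a * y))"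

definition is_strategy :: "real set \<Rightarrow> real set \<Rightarrow> (real \<Rightarrow> real) \<Rightarrow> bool" where
  "is_strategy K C \<sigma> \<longleftrightarrow> \<sigma> ` K \<subseteq> C \<and> \<sigma> C1_differentiable_on K"

(* \<Phi> t k stands for K(\<sigma>; t, k).  The flow is constrained only for t \<ge> 0 and k \<in> K, where it
   is required to exist and to remain in K; it is uniquely determined there when f and \<sigma> are
   continuously differentiable.  At t = 0 the derivative is one-sided. *)
definition is_flow ::
  "real set \<Rightarrow> (real \<Rightarrow> real) \<Rightarrow> (real \<Rightarrow> real) \<Rightarrow> (real \<Rightarrow> real \<Rightarrow> real) \<Rightarrow> bool" where
  "is_flow K f \<sigma> \<Phi> \<longleftrightarrow>
     (\<forall>k\<in>K. \<Phi> 0 k = k \<and>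
        (\<forall>t\<ge>0. \<Phi> t k \<in> K \<and>
           ((\<lambda>s. \<Phi> s k) has_real_derivative (f (\<Phi> t k) - \<sigma> (\<Phi> t k))) (at t within {0..})))"

definition flow_converges_to :: "real set \<Rightarrow> (real \<Rightarrow> real \<Rightarrow> real) \<Rightarrow> real \<Rightarrow> bool" where
  "flow_converges_to K \<Phi> kbar \<longleftrightarrow> (\<forall>k\<in>K. ((\<lambda>t. \<Phi> t k) \<longlongrightarrow> kbar) at_top)"

(* The gauge integral over {0..} of a continuous integrand exists exactly when the improper
   Riemann integral from 0 to infinity converges, possibly only conditionally. *)
definition differentiable_under_integral ::
  "real set \<Rightarrow> (real \<Rightarrow> real \<Rightarrow> real) \<Rightarrow> bool" where
  "differentiable_under_integral K F \<longleftrightarrow>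
     (\<forall>k\<in>K. (\<forall>t\<ge>0. (\<lambda>x. F t x) differentiable (at k)) \<and>
        (\<lambda>t. deriv (\<lambda>x. F t x) k) integrable_on {0..} \<and>
        ((\<lambda>x. integral {0..} (\<lambda>t. F t x)) has_real_derivative
           integral {0..} (\<lambda>t. deriv (\<lambda>x. F t x) k)) (at k))"

end

theory Submission
  imports Defs
begin

text \<open>
  Let \<open>W k\<close> be the right-hand side of the integrated equation, \<open>\<phi> = f - \<sigma>\<close> the drift and
  \<open>G = u \<circ> \<sigma>\<close>. The function \<open>h t * G (\<Phi> t k)\<close> tends to zero at infinity, since it and its derivative
  in \<open>t\<close> are integrable; integrating that derivative over \<open>{0..}\<close> therefore gives
  \<open>W' k * \<phi> k = - \<integral> h' t * G (\<Phi> t k) dt - G k\<close>, while the supremum is attained at \<open>\<sigma> k\<close>, because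
  \<open>u' (\<sigma> k) = v' k\<close>, and equals \<open>G k + v' k * \<phi> k\<close>. Hence the functional equation says exactly that
  \<open>(v - W)' * \<phi> = 0\<close>, i.e. that \<open>v - W\<close> is constant along the flow. As the flow converges
  to \<open>kbar\<close>, this determines \<open>v - W\<close> by its value at \<open>kbar\<close>, which the boundary condition makes zero.
\<close>

section \<open>Strict concavity: tangent lines and the derivative\<close>

lemma strictly_concave_on_imp_concave_on:
  fixes g :: "real \<Rightarrow> real"
  assumes "strictly_concave_on S g"
  shows "concave_on S g"
  unfolding concave_on_iff
proof (intro conjI ballI allI impI)
  show "convex S"
    using assms by (simp add: strictly_concave_on_def)
next
  fix x y a b :: real
  assume xy: "x \<in> S" "y \<in> S" and ab: "0 \<le> a" "0 \<le> b" "a + b = 1"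
  consider "x = y" | "b = 0" | "b = 1" | "x \<noteq> y" "0 < b" "b < 1"
    using ab by linarith
  then show "a * g x + b * g y \<le> g (a *\<^sub>R x + b *\<^sub>R y)"
  proof cases
    case 1
    have "a * g y + b * g y = g y" "a * y + b * y = y"
      using ab by (simp_all flip: distrib_right)
    then show ?thesis using 1 by simp
  next
    case 4
    have "a = 1 - b" using ab by simp
    then show ?thesis
      using 4 xy assms unfolding strictly_concave_on_def by (auto intro: less_imp_le)
  qed (use ab in auto)
qed

text \<open>With \<open>g = u\<close> and slope \<open>v' k\<close>, this makes
  \<open>i (v' k)\<close> a maximiser in the supremum. It is the tangent bound for the convex
  function \<open>- g\<close>, where openness of \<open>S\<close> makes \<open>x\<close>
  interior.\<close>

lemma strictly_concave_on_below_tangent: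
  fixes g :: "real \<Rightarrow> real"
  assumes "strictly_concave_on S g" "open S" "x \<in> S" "y \<in> S"
    and "(g has_real_derivative m) (at x)"
  shows "g y \<le> g x + m * (y - x)"
proof -
  have conv: "convex_on S (\<lambda>x. - g x)"
    using strictly_concave_on_imp_concave_on[OF assms(1)] by (simp add: concave_on_def)
  have "((\<lambda>x. - g x) has_real_derivative - m) (at x within S)"
    by (rule has_field_derivative_at_within[OF DERIV_minus[OF assms(5)]])
  moreover have "connected S"
    using assms(1) by (simp add: strictly_concave_on_def convex_connected)
  ultimately have "- m * (y - x) \<le> - g y - (- g x)"
    using convex_on_imp_above_tangent[OF conv, of x y "- m"] assms
    by (simp add: interior_open)
  then show ?thesis by simp
qed

text \<open>Equal slopes at \<open>x\<close> and \<open>y\<close> give two parallel tangents above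
  \<open>g\<close>. Averaged at the midpoint, their linear terms cancel and leave the mean of
  \<open>g x\<close> and \<open>g y\<close>, contradicting strictness. For \<open>u\<close> this
  makes \<open>the_inv_into C u'\<close> a genuine inverse on the range of
  \<open>u'\<close>.\<close>

lemma strictly_concave_on_inj_deriv:
  fixes g g' :: "real \<Rightarrow> real"
  assumes conc: "strictly_concave_on S g" and "open S"
    and deriv: "\<And>x. x \<in> S \<Longrightarrow> (g has_real_derivative g' x) (at x)"
  shows "inj_on g' S"
proof (rule inj_onI, rule ccontr)
  fix x y
  assume xy: "x \<in> S" "y \<in> S" "g' x = g' y" "x \<noteq> y"
  define m where "m = (1 - 1/2) * x + 1/2 * y"
  have "m \<in> S"
    using convexD[of S x y "1/2" "1/2"] conc xy by (simp add: strictly_concave_on_def m_def)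
  then have "g m \<le> g x + g' x * (m - x)" "g m \<le> g y + g' x * (m - y)"
    using strictly_concave_on_below_tangent[OF conc \<open>open S\<close>] deriv xy by metis+
  moreover have "(1 - 1/2) * g x + 1/2 * g y < g m"
    unfolding m_def
    using conc xy unfolding strictly_concave_on_def
    by (elim conjE ballE[of _ _ x] ballE[of _ _ y] allE[of _ "1/2"]) auto
  moreover have "g' x * (m - x) + g' x * (m - y) = 0"
    by (simp add: m_def field_simps)
  ultimately show False by (simp add: algebra_simps)
qed

section \<open>Limits at infinity and improper integrals\<close>

text \<open>The mean value theorem writes \<open>x (t + 1) - x t\<close> as a value of
  \<open>x'\<close> beyond \<open>t\<close>; as \<open>t\<close> grows, the increment tends to
  \<open>l - l\<close> and that value to \<open>m\<close>.\<close>

lemma deriv_limit_at_top_eq_0: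
  fixes x x' :: "real \<Rightarrow> real"
  assumes deriv: "\<And>t. t > 0 \<Longrightarrow> (x has_real_derivative x' t) (at t)"
    and lim: "(x \<longlongrightarrow> l) at_top" and lim': "(x' \<longlongrightarrow> m) at_top"
  shows "m = 0"
proof -
  have "\<exists>\<xi>. t < \<xi> \<and> x (t + 1) - x t = x' \<xi>" if "t > 0" for t
    using MVT2[of t "t + 1" x x'] deriv that by auto
  then obtain \<xi> where \<xi>: "\<And>t. t > 0 \<Longrightarrow> t < \<xi> t" "\<And>t. t > 0 \<Longrightarrow> x (t + 1) - x t = x' (\<xi> t)"
    by metis
  have "filterlim \<xi> at_top at_top"
    by (rule filterlim_at_top_mono[OF filterlim_ident])
       (auto intro!: eventually_mono[OF eventually_gt_at_top[of 0]] less_imp_le \<xi>)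
  then have "((\<lambda>t. x' (\<xi> t)) \<longlongrightarrow> m) at_top"
    by (rule filterlim_compose[OF lim'])
  moreover have "\<forall>\<^sub>F t in at_top. x' (\<xi> t) = x (t + 1) - x t"
    by (auto intro!: eventually_mono[OF eventually_gt_at_top[of 0]] simp: \<xi>)
  ultimately have "((\<lambda>t. x (t + 1) - x t) \<longlongrightarrow> m) at_top"
    by (simp add: tendsto_cong)
  moreover have "filterlim (\<lambda>t::real. t + 1) at_top at_top"
    by (rule filterlim_at_top_mono[OF filterlim_ident]) simp
  then have "((\<lambda>t. x (t + 1) - x t) \<longlongrightarrow> l - l) at_top"
    by (intro tendsto_diff lim filterlim_compose[OF lim])
  ultimately show ?thesis
    by (metis diff_self tendsto_unique trivial_limit_at_top_linorder)
qed

text \<open>Convergence may be merely conditional, so the argument rests on the gauge integral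
  itself, which every sufficiently large box approximates, rather than on dominated
  convergence.\<close>

lemma integral_tendsto_at_top:
  fixes g :: "real \<Rightarrow> real"
  assumes "g integrable_on {0..}"
  shows "((\<lambda>T. integral {0..T} g) \<longlongrightarrow> integral {0..} g) at_top"
proof (rule tendstoI)
  fix e :: real assume "e > 0"
  let ?g = "\<lambda>x. if x \<in> {0..} then g x else 0"
  have "(g has_integral integral {0..} g) {0..}"
    using assms by (rule integrable_integral)
  then obtain B where B: "B > 0"
    "\<And>a b. ball 0 B \<subseteq> cbox a b \<Longrightarrow> norm (integral (cbox a b) ?g - integral {0..} g) < e"
    unfolding has_integral_alt'[of g] using \<open>e > 0\<close> by blast
  show "\<forall>\<^sub>F T in at_top. dist (integral {0..T} g) (integral {0..} g) < e"
    using eventually_ge_at_top[of B]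
  proof eventually_elim
    case (elim T)
    \<comment> \<open>The integrand is extended by zero to the left of 0, so the symmetric box
      contributes exactly the integral over \<open>{0..T}\<close>.\<close>
    have "ball 0 B \<subseteq> cbox (- T) T"
      using elim by (auto simp: dist_real_def)
    moreover have "integral (cbox (- T) T) ?g = integral (cbox (- T) T \<inter> {0..}) g"
      by (subst Henstock_Kurzweil_Integration.integral_restrict_Int) (simp add: Int_commute)
    moreover have "cbox (- T) T \<inter> {0..} = {0..T}"
      using elim B(1) by auto
    ultimately show ?case
      using B(2)[of "- T" T] by (metis dist_norm)
  qed
qed

text \<open>Integrability of \<open>F'\<close> gives \<open>F\<close> a limit at infinity. The
  running integral of \<open>F\<close> converges too and has derivative \<open>F\<close>, so that
  limit is zero and only the boundary term at 0 survives.\<close>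

lemma fundamental_theorem_of_calculus_at_top:
  fixes F F' :: "real \<Rightarrow> real"
  assumes deriv: "\<And>t. 0 \<le> t \<Longrightarrow> (F has_real_derivative F' t) (at t within {0..})"
    and int: "F integrable_on {0..}" and int': "F' integrable_on {0..}"
  shows "integral {0..} F' = - F 0"
proof -
  have F_eq: "integral {0..T} F' = F T - F 0" if "T \<ge> 0" for T
    using that deriv
    by (intro integral_unique fundamental_theorem_of_calculus that)
       (auto simp flip: has_real_derivative_iff_has_vector_derivative
             intro!: has_field_derivative_subset[OF deriv])
  have "\<forall>\<^sub>F T in at_top. integral {0..T} F' = F T - F 0"
    using eventually_ge_at_top[of 0] by eventually_elim (rule F_eq)
  then have "((\<lambda>T. F T - F 0) \<longlongrightarrow> integral {0..} F') at_top"
    using integral_tendsto_at_top[OF int'] by (simp add: tendsto_cong)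
  from tendsto_add[OF this tendsto_const[of "F 0"]]
  have lim: "(F \<longlongrightarrow> integral {0..} F' + F 0) at_top" by simp
  have cont: "continuous_on {0..} F"
    by (rule DERIV_continuous_on) (use deriv in auto)
  have "((\<lambda>T. integral {0..T} F) has_real_derivative F t) (at t)" if "t > 0" for t
    using integral_has_real_derivative[of 0 "t + 1" F t] that
      continuous_on_subset[OF cont, of "{0..t + 1}"]
    by (simp add: at_within_Icc_at subset_iff)
  then have "integral {0..} F' + F 0 = 0"
    using integral_tendsto_at_top[OF int] lim by (rule deriv_limit_at_top_eq_0)
  then show ?thesis by simp
qed

section \<open>Uniqueness for autonomous equations and its consequences for the flow\<close>

lemma C1_imp_lipschitz_Icc:
  fixes g :: "real \<Rightarrow> real"
  assumes "g C1_differentiable_on {a..b}"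
  obtains L where "\<And>x y. x \<in> {a..b} \<Longrightarrow> y \<in> {a..b} \<Longrightarrow> \<bar>g x - g y\<bar> \<le> L * \<bar>x - y\<bar>"
proof -
  obtain D where D: "\<And>x. x \<in> {a..b} \<Longrightarrow> (g has_real_derivative D x) (at x)"
      and cont: "continuous_on {a..b} D"
    using assms unfolding C1_differentiable_on_def has_real_derivative_iff_has_vector_derivative
    by blast
  have "bounded (D ` {a..b})"
    by (intro compact_imp_bounded compact_continuous_image cont) simp
  then obtain L where L: "\<And>x. x \<in> {a..b} \<Longrightarrow> norm (D x) \<le> L"
    unfolding bounded_iff by blast
  have "norm (g x - g y) \<le> L * norm (x - y)" if "x \<in> {a..b}" "y \<in> {a..b}" for x y
    by (rule field_differentiable_bound[of "{a..b}" g D])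
       (use that D L in \<open>auto intro: has_field_derivative_at_within\<close>)
  then show ?thesis
    using that[of L] by simp
qed

text \<open>A Gronwall argument: for a Lipschitz constant \<open>L\<close>, the squared distance
  damped by \<open>exp (- 2 * L * t)\<close> cannot grow from its initial value zero.\<close>

lemma autonomous_ode_unique:
  fixes \<phi> x y :: "real \<Rightarrow> real"
  assumes K: "is_interval K" and C1: "\<phi> C1_differentiable_on K"
    and x: "\<And>t. 0 \<le> t \<Longrightarrow> (x has_real_derivative \<phi> (x t)) (at t within {0..})"
    and y: "\<And>t. 0 \<le> t \<Longrightarrow> (y has_real_derivative \<phi> (y t)) (at t within {0..})"
    and xK: "\<And>t. 0 \<le> t \<Longrightarrow> x t \<in> K" and yK: "\<And>t. 0 \<le> t \<Longrightarrow> y t \<in> K"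
    and init: "x 0 = y 0" and "0 \<le> T"
  shows "x T = y T"
proof -
  have "continuous_on {0..} x" "continuous_on {0..} y"
    by (rule DERIV_continuous_on; use x y in auto)+
  then have "continuous_on {0..T} x" "continuous_on {0..T} y"
    by (auto intro: continuous_on_subset)
  then have cpt: "compact (x ` {0..T} \<union> y ` {0..T})" (is "compact ?S")
    by (intro compact_Un compact_continuous_image) auto
  have ne: "?S \<noteq> {}" using \<open>0 \<le> T\<close> by auto
  \<comment> \<open>\<open>a\<close> and \<open>b\<close> are the extreme values of both
    trajectories up to time \<open>T\<close>. Being attained, they lie in \<open>K\<close>, so
    \<open>{a..b}\<close> is a compact subinterval of \<open>K\<close>, on which \<phi> is Lipschitz
    even if it is not so on all of \<open>K\<close>.\<close>
  obtain a where a: "a \<in> ?S" "\<And>z. z \<in> ?S \<Longrightarrow> a \<le> z"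
    using compact_attains_inf[OF cpt ne] by auto
  obtain b where b: "b \<in> ?S" "\<And>z. z \<in> ?S \<Longrightarrow> z \<le> b"
    using compact_attains_sup[OF cpt ne] by auto
  have "a \<in> K" "b \<in> K"
    using a(1) b(1) xK yK by auto
  then have "{a..b} \<subseteq> K"
    using mem_is_interval_1_I[OF K] by (meson atLeastAtMost_iff subsetI)
  then obtain L where L: "\<And>z w. z \<in> {a..b} \<Longrightarrow> w \<in> {a..b} \<Longrightarrow> \<bar>\<phi> z - \<phi> w\<bar> \<le> L * \<bar>z - w\<bar>"
    using C1_imp_lipschitz_Icc C1 C1_differentiable_on_subset by metis
  define E where "E t = (x t - y t)\<^sup>2 * exp (- 2 * L * t)" for t
  define E' where
    "E' t = 2 * exp (- 2 * L * t) * ((x t - y t) * (\<phi> (x t) - \<phi> (y t)) - L * (x t - y t)\<^sup>2)" for t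
  have E: "(E has_real_derivative E' t) (at t within {0..T})" if "t \<in> {0..T}" for t
  proof -
    have "(x has_real_derivative \<phi> (x t)) (at t within {0..T})"
         "(y has_real_derivative \<phi> (y t)) (at t within {0..T})"
      using that by (auto intro: has_field_derivative_subset x y)
    then show ?thesis
      unfolding E_def[abs_def] E'_def
      by (auto intro!: derivative_eq_intros simp: algebra_simps power2_eq_square)
  qed
  have E'_nonpos: "E' t \<le> 0" if "t \<in> {0..T}" for t
  proof -
    have "(x t - y t) * (\<phi> (x t) - \<phi> (y t)) \<le> \<bar>x t - y t\<bar> * \<bar>\<phi> (x t) - \<phi> (y t)\<bar>"
      by (metis abs_ge_self abs_mult)
    also have "\<dots> \<le> \<bar>x t - y t\<bar> * (L * \<bar>x t - y t\<bar>)"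
      using L[of "x t" "y t"] a b that by (intro mult_left_mono) auto
    also have "\<dots> = L * (x t - y t)\<^sup>2"
      by (simp add: power2_eq_square)
    finally show ?thesis
      unfolding E'_def by (simp add: mult_nonneg_nonpos)
  qed
  have "E T \<le> E 0"
  proof (rule DERIV_nonpos_imp_decreasing_open[OF \<open>0 \<le> T\<close>])
    show "continuous_on {0..T} E"
      by (rule DERIV_continuous_on[OF E])
    show "\<exists>y. (E has_real_derivative y) (at t) \<and> y \<le> 0" if "0 < t" "t < T" for t
      using E[of t] E'_nonpos[of t] that by (auto simp: at_within_Icc_at)
  qed
  then have "(x T - y T)\<^sup>2 * exp (- 2 * L * T) \<le> 0"
    by (simp add: E_def init)
  then show ?thesis
    by (simp add: mult_le_0_iff not_le)
qed

text \<open>Both sides solve the same autonomous equation in \<open>t\<close>, the right one by time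
  translation, and they agree at \<open>t = 0\<close>.\<close>

lemma is_flow_semigroup:
  assumes "is_interval K" "(\<lambda>k. f k - \<sigma> k) C1_differentiable_on K" "is_flow K f \<sigma> \<Phi>"
    and "k \<in> K" "0 \<le> s" "0 \<le> t"
  shows "\<Phi> t (\<Phi> s k) = \<Phi> (t + s) k"
proof -
  note flow = assms(3)[unfolded is_flow_def, rule_format]
  have sk: "\<Phi> s k \<in> K"
    using flow assms by blast
  have shift: "((\<lambda>t. \<Phi> (t + s) k) has_real_derivative f (\<Phi> (r + s) k) - \<sigma> (\<Phi> (r + s) k)) (at r within {0..})"
    if "0 \<le> r" for r
  proof -
    have "((\<lambda>t. \<Phi> t k) has_real_derivative f (\<Phi> (r + s) k) - \<sigma> (\<Phi> (r + s) k)) (at (r + s) within {0..})"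
      using flow assms that by auto
    \<comment> \<open>The one-sided chain rule asks for the derivative within the shifted half-line,
      which lies in \<open>{0..}\<close> because \<open>0 \<le> s\<close>.\<close>
    then have "((\<lambda>t. \<Phi> t k) has_real_derivative f (\<Phi> (r + s) k) - \<sigma> (\<Phi> (r + s) k))
        (at (r + s) within (\<lambda>t. t + s) ` {0..})"
      by (rule has_field_derivative_subset) (use \<open>0 \<le> s\<close> in auto)
    moreover have "((\<lambda>t. t + s) has_real_derivative 1) (at r within {0..})"
      by (auto intro!: derivative_eq_intros)
    ultimately show ?thesis
      using DERIV_image_chain[of "\<lambda>t. \<Phi> t k" _ "\<lambda>t. t + s" r "{0..}" 1] by (simp add: o_def)
  qed
  show ?thesis
    by (rule autonomous_ode_unique[OF assms(1,2), of "\<lambda>t. \<Phi> t (\<Phi> s k)" "\<lambda>t. \<Phi> (t + s) k"])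
       (use flow[OF sk] flow[OF \<open>k \<in> K\<close>] assms(5,6) shift in simp_all)
qed

text \<open>The velocity along the trajectory from \<open>kbar\<close> tends to the drift at
  \<open>kbar\<close>; as the trajectory itself converges, this limit is zero. The constant
  \<open>kbar\<close> is then a solution, and uniqueness identifies it with the trajectory.\<close>

lemma flow_limit_is_fixed_point:
  assumes K: "open K" "is_interval K" "kbar \<in> K"
    and C1: "(\<lambda>k. f k - \<sigma> k) C1_differentiable_on K"
    and flow: "is_flow K f \<sigma> \<Phi>" and conv: "flow_converges_to K \<Phi> kbar"
  shows "f kbar = \<sigma> kbar" and "0 \<le> t \<Longrightarrow> \<Phi> t kbar = kbar"
proof -
  let ?\<phi> = "\<lambda>k. f k - \<sigma> k"
  note flowD = flow[unfolded is_flow_def, rule_format]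
  have lim: "((\<lambda>t. \<Phi> t kbar) \<longlongrightarrow> kbar) at_top"
    using conv K by (simp add: flow_converges_to_def)
  have "isCont ?\<phi> kbar"
    using C1_differentiable_imp_continuous_on[OF C1] K by (simp add: continuous_on_eq_continuous_at)
  then have lim': "((\<lambda>t. ?\<phi> (\<Phi> t kbar)) \<longlongrightarrow> ?\<phi> kbar) at_top"
    using lim by (rule isCont_tendsto_compose)
  have "((\<lambda>t. \<Phi> t kbar) has_real_derivative ?\<phi> (\<Phi> t kbar)) (at t)" if "t > 0" for t
  proof -
    have "at t within {0..} = at t"
      by (rule at_within_interior) (use that in simp)
    then show ?thesis
      using flowD[OF K(3)] that by (metis less_imp_le)
  qed
  then have zero: "?\<phi> kbar = 0"
    using lim lim' by (rule deriv_limit_at_top_eq_0)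
  then show "f kbar = \<sigma> kbar" by simp
  show "\<Phi> t kbar = kbar" if "0 \<le> t"
    by (rule autonomous_ode_unique[OF K(2) C1, of "\<lambda>t. \<Phi> t kbar" "\<lambda>t. kbar"])
       (use flowD[OF K(3)] K(3) zero that in simp_all)
qed

section \<open>Differentiating the discounted value along the flow\<close>

text \<open>Differentiating \<open>G (\<Phi> t (\<Phi> s k)) = G (\<Phi> (t + s) k)\<close> at \<open>s = 0\<close> trades the derivative
  in the initial value for the derivative in time, so that smoothness of \<open>\<Phi> t\<close> is not needed.\<close>
lemma deriv_along_flow:
  fixes G G' :: "real \<Rightarrow> real"
  assumes K: "is_interval K" and C1: "(\<lambda>k. f k - \<sigma> k) C1_differentiable_on K"
    and flow: "is_flow K f \<sigma> \<Phi>"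
    and G: "\<And>k. k \<in> K \<Longrightarrow> (G has_real_derivative G' k) (at k)"
    and diff: "(\<lambda>x. a * G (\<Phi> t x)) differentiable (at k)"
    and kt: "k \<in> K" "0 \<le> t"
  shows "deriv (\<lambda>x. a * G (\<Phi> t x)) k * (f k - \<sigma> k)
       = a * (G' (\<Phi> t k) * (f (\<Phi> t k) - \<sigma> (\<Phi> t k)))"
proof -
  note flowD = flow[unfolded is_flow_def, rule_format]
  let ?A = "\<lambda>x. a * G (\<Phi> t x)"
  have A: "(?A has_real_derivative deriv ?A k) (at k)"
    using diff by (simp add: DERIV_deriv_iff_real_differentiable)
  have d0: "((\<lambda>s. \<Phi> s k) has_real_derivative f k - \<sigma> k) (at 0 within {0..})"
    using flowD[OF kt(1)] by (metis order_refl)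
  \<comment> \<open>First computation: the initial value moves, and the two-sided derivative of
    \<open>?A\<close> at \<open>k\<close> is composed with the one-sided derivative of the
    trajectory at 0.\<close>
  have "((\<lambda>s. ?A (\<Phi> s k)) has_real_derivative deriv ?A k * (f k - \<sigma> k)) (at 0 within {0..})"
    using DERIV_chain2[OF _ d0, of ?A] A flowD[OF kt(1)] by simp
  then have 1: "((\<lambda>s. a * G (\<Phi> (t + s) k)) has_real_derivative deriv ?A k * (f k - \<sigma> k)) (at 0 within {0..})"
    unfolding has_field_derivative_def by (rule has_derivative_transform[rotated 2])
       (use is_flow_semigroup[OF K C1 flow kt(1) _ kt(2)] in auto)
  \<comment> \<open>Second computation: the time argument moves on from \<open>t\<close>, so only
    the derivative of \<open>G\<close> at \<open>\<Phi> t k\<close> enters.\<close>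
  have "((\<lambda>r. \<Phi> r k) has_real_derivative f (\<Phi> t k) - \<sigma> (\<Phi> t k)) (at (t + 0) within (+) t ` {0..})"
    using flowD[OF kt(1)] kt by (auto intro: has_field_derivative_subset)
  moreover have "((+) t has_real_derivative 1) (at 0 within {0..})"
    by (auto intro!: derivative_eq_intros)
  ultimately have d: "((\<lambda>s. \<Phi> (t + s) k) has_real_derivative f (\<Phi> t k) - \<sigma> (\<Phi> t k)) (at 0 within {0..})"
    using DERIV_image_chain[of "\<lambda>r. \<Phi> r k" _ "(+) t" 0 "{0..}" 1] by (simp add: o_def)
  have "(G has_real_derivative G' (\<Phi> t k)) (at (\<Phi> (t + 0) k))"
    using G flowD[OF kt(1)] kt(2) by simp
  from DERIV_cmult[OF DERIV_chain2[OF this d], of a]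
  have 2: "((\<lambda>s. a * G (\<Phi> (t + s) k)) has_real_derivative
      a * (G' (\<Phi> t k) * (f (\<Phi> t k) - \<sigma> (\<Phi> t k)))) (at 0 within {0..})" .
  have "at (0::real) within {0..} \<noteq> bot"
    by (simp add: at_within_Ici_at_right)
  then show ?thesis
    using 1 2 unfolding has_field_derivative_iff by (rule tendsto_unique)
qed

text \<open>The time derivative of \<open>h t * G (\<Phi> t k)\<close> is
  \<open>h' t * G (\<Phi> t k)\<close> plus a transport term, which by
  \<open>deriv_along_flow\<close> is the derivative in \<open>k\<close> times the drift. Over the
  half-line the transport term integrates to \<open>W'\<close> times the drift, and the total is
  \<open>- G k\<close> because \<open>h 0 = 1\<close>.\<close>

lemma has_real_derivative_discounted_value:
  fixes G G' h h' :: "real \<Rightarrow> real"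
  assumes K: "is_interval K" and C1: "(\<lambda>k. f k - \<sigma> k) C1_differentiable_on K"
    and flow: "is_flow K f \<sigma> \<Phi>"
    and G: "\<And>k. k \<in> K \<Longrightarrow> (G has_real_derivative G' k) (at k)"
    and h: "\<And>t. 0 \<le> t \<Longrightarrow> (h has_real_derivative h' t) (at t within {0..})" "h 0 = 1"
    and int: "(\<lambda>t. h t * G (\<Phi> t k)) integrable_on {0..}"
    and int': "(\<lambda>t. h' t * G (\<Phi> t k)) integrable_on {0..}"
    and under: "differentiable_under_integral K (\<lambda>t k. h t * G (\<Phi> t k))"
    and k: "k \<in> K"
  obtains W' where
    "((\<lambda>x. integral {0..} (\<lambda>t. h t * G (\<Phi> t x))) has_real_derivative W') (at k)"
    and "W' * (f k - \<sigma> k) = - integral {0..} (\<lambda>t. h' t * G (\<Phi> t k)) - G k"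
proof
  note flowD = flow[unfolded is_flow_def, rule_format, OF k]
  note underD = under[unfolded differentiable_under_integral_def, rule_format, OF k]
  let ?d = "\<lambda>t. deriv (\<lambda>x. h t * G (\<Phi> t x)) k"
  show "((\<lambda>x. integral {0..} (\<lambda>t. h t * G (\<Phi> t x))) has_real_derivative integral {0..} ?d) (at k)"
    using underD by blast
  have int_d: "(\<lambda>t. ?d t * (f k - \<sigma> k)) integrable_on {0..}"
    using underD by (intro integrable_on_mult_left) blast
  have "((\<lambda>t. h t * G (\<Phi> t k)) has_real_derivative h' t * G (\<Phi> t k) + ?d t * (f k - \<sigma> k))
      (at t within {0..})" if "0 \<le> t" for t
  proof -
    have eq: "?d t * (f k - \<sigma> k) = h t * (G' (\<Phi> t k) * (f (\<Phi> t k) - \<sigma> (\<Phi> t k)))"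
      using underD that k by (intro deriv_along_flow[OF K C1 flow G]) auto
    have "((\<lambda>t. G (\<Phi> t k)) has_real_derivative G' (\<Phi> t k) * (f (\<Phi> t k) - \<sigma> (\<Phi> t k)))
        (at t within {0..})"
      using flowD that by (intro DERIV_chain2[of G]) (auto intro: G)
    from DERIV_mult[OF h(1)[OF that] this] show ?thesis
      unfolding eq by (simp add: mult.commute)
  qed
  from fundamental_theorem_of_calculus_at_top[OF this int integrable_add[OF int' int_d]]
  have "integral {0..} (\<lambda>t. h' t * G (\<Phi> t k)) + integral {0..} (\<lambda>t. ?d t * (f k - \<sigma> k)) = - G k"
    using integral_add[OF int' int_d] h(2) flowD by simp
  then show "integral {0..} ?d * (f k - \<sigma> k)
      = - integral {0..} (\<lambda>t. h' t * G (\<Phi> t k)) - G k"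
    by simp
qed

theorem proposition3:
  fixes C K :: "real set"
    and u u' i h h' f v v' :: "real \<Rightarrow> real"
    and \<Phi> :: "real \<Rightarrow> real \<Rightarrow> real"
    and kbar :: real
  assumes C: "open C" "is_interval C"
    and u_mono: "strict_mono_on C u"
    and u_deriv: "\<And>c. c \<in> C \<Longrightarrow> (u has_real_derivative u' c) (at c)"
    and u_C2: "u' C1_differentiable_on C"
    and u_concave: "strictly_concave_on C u"
    and i: "i = the_inv_into C u'"
    and h_nonneg: "\<And>t. 0 \<le> t \<Longrightarrow> 0 \<le> h t"
    and h_deriv: "\<And>t. 0 \<le> t \<Longrightarrow> (h has_real_derivative h' t) (at t within {0..})"
    and h_C1: "continuous_on {0..} h'"
    and h_0: "h 0 = 1"
    and h_integrable: "h integrable_on {0..}"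
    and K: "open K" "is_interval K" "kbar \<in> K"
    and f_mono: "strict_mono_on K f"
    and f_concave: "concave_on K f"
    and f_C1: "f C1_differentiable_on K"
    and v_deriv: "\<And>k. k \<in> K \<Longrightarrow> (v has_real_derivative v' k) (at k)"
    and v_C2: "v' C1_differentiable_on K"
    and v'_range: "v' ` K \<subseteq> u' ` C"
    and strategy: "is_strategy K C (i \<circ> v')"
    and flow: "is_flow K f (i \<circ> v') \<Phi>"
    and convergence: "flow_converges_to K \<Phi> kbar"
    and integrable_h:
      "\<And>k. k \<in> K \<Longrightarrow> (\<lambda>t. h t * u ((i \<circ> v') (\<Phi> t k))) integrable_on {0..}"
    and integrable_h':
      "\<And>k. k \<in> K \<Longrightarrow> (\<lambda>t. h' t * u ((i \<circ> v') (\<Phi> t k))) integrable_on {0..}"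
    and under_integral:
      "differentiable_under_integral K (\<lambda>t k. h t * u ((i \<circ> v') (\<Phi> t k)))"
  shows
    "(\<forall>k\<in>K. v k = integral {0..} (\<lambda>t. h t * u ((i \<circ> v') (\<Phi> t k))))
     \<longleftrightarrow>
     (\<forall>k\<in>K. - integral {0..} (\<lambda>t. h' t * (u \<circ> i) (v' (\<Phi> t k)))
             = (SUP c\<in>C. u c + v' k * (f k - c)))
     \<and> v kbar = u (f kbar) * integral {0..} h"
proof -
  define \<sigma> where "\<sigma> = i \<circ> v'"
  define G where "G x = u (\<sigma> x)" for x
  define W where "W k = integral {0..} (\<lambda>t. h t * G (\<Phi> t k))" for k
  note flow = flow[folded \<sigma>_def]
  note flowD = flow[unfolded is_flow_def, rule_format]
  have \<sigma>C: "\<sigma> k \<in> C" if "k \<in> K" for k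
    using strategy that by (auto simp: is_strategy_def \<sigma>_def)
  have \<sigma>C1: "\<sigma> C1_differentiable_on K"
    using strategy by (simp add: is_strategy_def \<sigma>_def)
  then obtain \<sigma>' where \<sigma>': "\<And>k. k \<in> K \<Longrightarrow> (\<sigma> has_real_derivative \<sigma>' k) (at k)"
    unfolding C1_differentiable_on_def has_real_derivative_iff_has_vector_derivative by blast
  have C1: "(\<lambda>k. f k - \<sigma> k) C1_differentiable_on K"
    using C1_differentiable_on_diff[OF f_C1 \<sigma>C1] .
  have G: "(G has_real_derivative u' (\<sigma> k) * \<sigma>' k) (at k)" if "k \<in> K" for k
    unfolding G_def[abs_def] using that by (intro DERIV_chain2[of u] u_deriv \<sigma>C \<sigma>')
  have "inj_on u' C"
    by (rule strictly_concave_on_inj_deriv[OF u_concave C(1) u_deriv])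
  then have foc: "u' (\<sigma> k) = v' k" if "k \<in> K" for k
    using f_the_inv_into_f[of u' C "v' k"] v'_range that by (auto simp: \<sigma>_def i)
  have sup_eq: "(SUP c\<in>C. u c + v' k * (f k - c)) = G k + v' k * (f k - \<sigma> k)" if "k \<in> K" for k
  proof (rule cSup_eq_maximum)
    show "G k + v' k * (f k - \<sigma> k) \<in> (\<lambda>c. u c + v' k * (f k - c)) ` C"
      using \<sigma>C that by (auto simp: G_def)
    fix z
    assume "z \<in> (\<lambda>c. u c + v' k * (f k - c)) ` C"
    then obtain c where c: "c \<in> C" "z = u c + v' k * (f k - c)" by auto
    have "u c \<le> u (\<sigma> k) + v' k * (c - \<sigma> k)"
      using strictly_concave_on_below_tangent[OF u_concave C(1) \<sigma>C[OF that] c(1) u_deriv[OF \<sigma>C[OF that]]]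
        foc that by simp
    then show "z \<le> G k + v' k * (f k - \<sigma> k)"
      by (simp add: c G_def algebra_simps)
  qed
  have "\<exists>W'. (W has_real_derivative W') (at k)
      \<and> W' * (f k - \<sigma> k) = - integral {0..} (\<lambda>t. h' t * G (\<Phi> t k)) - G k" if k: "k \<in> K" for k
    by (rule has_real_derivative_discounted_value[where h = h and h' = h', OF K(2) C1 flow G h_deriv h_0 _ _ _ k])
       (use integrable_h[OF k] integrable_h'[OF k] under_integral in
          \<open>auto simp: G_def \<sigma>_def W_def[abs_def]\<close>)
  then obtain W' where W: "\<And>k. k \<in> K \<Longrightarrow> (W has_real_derivative W' k) (at k)"
    and W': "\<And>k. k \<in> K \<Longrightarrow>
      W' k * (f k - \<sigma> k) = - integral {0..} (\<lambda>t. h' t * G (\<Phi> t k)) - G k"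
    by metis
  note fixed = flow_limit_is_fixed_point[OF K C1 flow convergence]
  \<comment> \<open>Started at \<open>kbar\<close> the flow does not move and
    \<open>\<sigma> kbar = f kbar\<close>, so the utility is constant in time and factors
    out.\<close>
  have "W kbar = integral {0..} (\<lambda>t. h t * u (f kbar))"
    unfolding W_def by (rule integral_cong) (simp add: fixed G_def)
  then have Wbar: "W kbar = u (f kbar) * integral {0..} h"
    by (simp add: mult.commute)
  \<comment> \<open>The drift factor is not cancelled, since it vanishes at \<open>kbar\<close>; the
    products alone control \<open>v - W\<close> along trajectories.\<close>
  have "(\<forall>k\<in>K. v k = W k) \<longleftrightarrow>
      (\<forall>k\<in>K. W' k * (f k - \<sigma> k) = v' k * (f k - \<sigma> k)) \<and> v kbar = W kbar"
  proof (intro iffI conjI ballI)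
    fix k assume vW: "\<forall>k\<in>K. v k = W k" and k: "k \<in> K"
    \<comment> \<open>\<open>K\<close> is open, so \<open>v\<close> and \<open>W\<close> agree near
      \<open>k\<close> and share their derivative there.\<close>
    have "(v has_real_derivative W' k) (at k)"
      using has_field_derivative_transform_within_open[OF W[OF k] K(1) k] vW by simp
    then show "W' k * (f k - \<sigma> k) = v' k * (f k - \<sigma> k)"
      using v_deriv[OF k] DERIV_unique by metis
  next
    fix k
    assume *: "(\<forall>k\<in>K. W' k * (f k - \<sigma> k) = v' k * (f k - \<sigma> k)) \<and> v kbar = W kbar"
      and k: "k \<in> K"
    \<comment> \<open>By the chain rule the time derivative of \<open>?D\<close> is
      \<open>v' - W'\<close> times the drift, taken at \<open>\<Phi> t k\<close>, hence zero. So
      \<open>?D\<close> keeps its initial value \<open>v k - W k\<close>, which must equal its limit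
      \<open>v kbar - W kbar\<close>.\<close>
    let ?D = "\<lambda>t. v (\<Phi> t k) - W (\<Phi> t k)"
    have "(?D has_real_derivative 0) (at t within {0..})" if "0 \<le> t" for t
    proof -
      have "((\<lambda>x. v x - W x) has_real_derivative v' (\<Phi> t k) - W' (\<Phi> t k)) (at (\<Phi> t k))"
        using flowD[OF k] that by (intro DERIV_diff v_deriv W) auto
      moreover have "((\<lambda>s. \<Phi> s k) has_real_derivative f (\<Phi> t k) - \<sigma> (\<Phi> t k)) (at t within {0..})"
        and "\<Phi> t k \<in> K"
        using flowD[OF k] that by auto
      ultimately show ?thesis
        using DERIV_chain2[of "\<lambda>x. v x - W x" _ "\<lambda>s. \<Phi> s k" t] * by (fastforce simp: left_diff_distrib)
    qed
    then have "\<exists>c. \<forall>t\<in>{0..}. ?D t = c"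
      by (intro has_field_derivative_zero_constant) auto
    then have D0: "?D t = ?D 0" if "0 \<le> t" for t
      using that by fastforce
    have "isCont (\<lambda>x. v x - W x) kbar"
      using K(3) by (intro isCont_diff DERIV_isCont[OF v_deriv] DERIV_isCont[OF W])
    then have "(?D \<longlongrightarrow> v kbar - W kbar) at_top"
      by (rule isCont_tendsto_compose) (use convergence k in \<open>auto simp: flow_converges_to_def\<close>)
    moreover have "(?D \<longlongrightarrow> ?D 0) at_top"
      by (rule tendsto_eventually[OF eventually_mono[OF eventually_ge_at_top[of 0] D0]])
    ultimately have "?D 0 = v kbar - W kbar"
      using tendsto_unique trivial_limit_at_top_linorder by blast
    then show "v k = W k"
      using * flowD[OF k] by simp
  qed (use K in auto)
  \<comment> \<open>Once the formulas for \<open>W'\<close> and for the supremum are inserted,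
    \<open>G k\<close> appears on both sides and cancels.\<close>
  moreover have "(- integral {0..} (\<lambda>t. h' t * (u \<circ> i) (v' (\<Phi> t k))) = (SUP c\<in>C. u c + v' k * (f k - c)))
      \<longleftrightarrow> W' k * (f k - \<sigma> k) = v' k * (f k - \<sigma> k)" if "k \<in> K" for k
    using W'[OF that] sup_eq[OF that] by (auto simp: G_def \<sigma>_def)
  ultimately show ?thesis
    unfolding Wbar by (simp add: W_def G_def \<sigma>_def)
qed

end
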